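(* For each $x\in\Gamma_L$ and $z\in\mathbb{R}^3$, define $g_{xz}\in L^2(K)$ by $$g_{xz}(s):=e^{is|x-z|},\quad s\in K.$$ For $y\in D$ put $\tau:=|x-z|-|x-y|$. Then $$(\mathcal{P}_x^*g_{xz})(y)=\begin{cases} k_{max}, & \text{if } \tau=0,\\[1mm] \dfrac{e^{i\tau k_{max}}-1}{i\tau}, & \text{if } \tau\neq 0,\end{cases}\qquad y\in D.$$ In particular, $(\mathcal{P}_x^*g_{xz})(y)=(\mathcal{P}_x^*g_{xz})(y^* )$ for $y,y^*\in D$ with $|y-x|=|y^*-x|$. Furthermore, $$|(\mathcal{P}_x^*g_{xz})(y)|\le k_{max},\quad y\in D,$$ where equality holds if and only if $\tau=0$. Moreover, the following asymptotic holds: $$|(\mathcal{P}_x^*g_{xz})(y)|=\mathcal{O}\left(\frac{1}{\tau}\right),\quad \tau\to\infty.$$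
   Context: $D\subset\mathbb{R}^3$ is a bounded Lipschitz domain with connected complement $\mathbb{R}^3\setminus\overline{D}$, $k_{max}>0$, $K:=(0,k_{max}]$, and $\Gamma_L=\{x_1,\dots,x_L\}\subset\mathbb{R}^3\setminus\overline{D}$ is a finite set of measurement points. For $x\in\Gamma_L$ the operator $\mathcal{P}_x^*: L^2(K)\to L^2(D)$ is $$(\mathcal{P}_x^*\phi)(y):=\int_K e^{-is|x-y|}\phi(s)\,ds,\quad y\in D.$$ The asymptotic statement means: there exist constants $C,T>0$ such that $|(\mathcal{P}_x^*g_{xz})(y)|\le C/\tau$ for all $y\in D$ and $z\in\mathbb{R}^3$ with $\tau=|x-z|-|x-y|\ge T$. *)

theory Defs
  imports "HOL-Analysis.Analysis"
begin

text \<open>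
  A domain is a nonempty open connected set. It is Lipschitz if, near every boundary point
  and in suitably rotated coordinates, it is the region strictly above the graph of a
  Lipschitz function of the first two coordinates.
\<close>

definition lipschitz_domain :: "(real^3) set \<Rightarrow> bool" where
  "lipschitz_domain D \<longleftrightarrow>
     D \<noteq> {} \<and> open D \<and> connected D \<and>
     (\<forall>p\<in>frontier D. \<exists>r>0. \<exists>Q :: real^3 \<Rightarrow> real^3. \<exists>\<gamma> :: real^2 \<Rightarrow> real. \<exists>M.
        orthogonal_transformation Q \<and> M-lipschitz_on UNIV \<gamma> \<and>
        D \<inter> ball p r = {y \<in> ball p r. \<gamma> (vector [Q y $ 1, Q y $ 2]) < Q y $ 3})"

text \<open>
  Elements of \<open>L\<^sup>2(S)\<close> are represented by functions; values outside \<open>S\<close> are irrelevant.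
  That the operator below respects equality almost everywhere and maps \<open>L\<^sup>2(K)\<close> into
  \<open>L\<^sup>2(D)\<close> is shown in \<open>Pstar_cong_AE\<close> and \<open>Pstar_in_L2\<close>.
\<close>

definition L2 :: "'a::euclidean_space set \<Rightarrow> ('a \<Rightarrow> complex) set" where
  "L2 S = {f \<in> borel_measurable (lebesgue_on S).
             integrable (lebesgue_on S) (\<lambda>x. (norm (f x))\<^sup>2)}"

definition Pstar :: "real \<Rightarrow> real^3 \<Rightarrow> (real \<Rightarrow> complex) \<Rightarrow> real^3 \<Rightarrow> complex" where
  "Pstar kmax x \<phi> y =
     (LINT s|lebesgue_on {0<..kmax}. exp (- \<i> * of_real (s * norm (x - y))) * \<phi> s)"

definition g :: "real^3 \<Rightarrow> real^3 \<Rightarrow> real \<Rightarrow> complex" where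
  "g x z s = exp (\<i> * of_real (s * norm (x - z)))"

lemma Pstar_cong_AE:
  assumes "\<phi> \<in> L2 {0<..kmax}" "\<psi> \<in> L2 {0<..kmax}"
    and "AE s in lebesgue_on {0<..kmax}. \<phi> s = \<psi> s"
  shows "Pstar kmax x \<phi> y = Pstar kmax x \<psi> y"
proof -
  let ?M = "lebesgue_on {0<..kmax}"
  have e: "(\<lambda>s. exp (- \<i> * of_real (s * norm (x - y)))) \<in> borel_measurable ?M"
    by (intro continuous_imp_measurable_on_sets_lebesgue continuous_intros) auto
  show ?thesis
    unfolding Pstar_def using assms e
    by (intro integral_cong_AE) (auto simp: L2_def elim!: eventually_mono)
qed

lemma Pstar_in_L2:
  assumes "bounded D" "open D" and \<phi>: "\<phi> \<in> L2 {0<..kmax}"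
  shows "Pstar kmax x \<phi> \<in> L2 D"
proof -
  let ?M = "lebesgue_on {0<..kmax}"
  have fin: "finite_measure ?M"
    by (intro finite_measure_lebesgue_on bounded_set_imp_lmeasurable) auto
  then interpret finite_measure ?M .
  have m: "\<phi> \<in> borel_measurable ?M" and i: "integrable ?M (\<lambda>s. (norm (\<phi> s))\<^sup>2)"
    using \<phi> by (auto simp: L2_def)
  have "Pstar kmax x \<phi> \<in> borel_measurable borel"
    unfolding Pstar_def[abs_def]
  proof (rule borel_measurable_lebesgue_integral)
    have fs: "(\<lambda>p. snd p) \<in> borel_measurable (borel \<Otimes>\<^sub>M ?M)"
      by (rule measurable_compose[OF measurable_snd])
         (auto intro!: continuous_imp_measurable_on_sets_lebesgue continuous_intros)
    have ff: "(\<lambda>p. fst p) \<in> borel_measurable ((borel :: (real^3) measure) \<Otimes>\<^sub>M ?M)"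
      by (rule measurable_fst)
    show "(\<lambda>(y, s). exp (- \<i> * of_real (s * norm (x - y))) * \<phi> s)
            \<in> borel_measurable (borel \<Otimes>\<^sub>M ?M)"
    proof -
      have "(\<lambda>p. snd p * norm (x - fst p)) \<in> borel_measurable (borel \<Otimes>\<^sub>M ?M)"
        using fs ff by measurable
      moreover have "(\<lambda>r::real. exp (- \<i> * of_real r)) \<in> borel_measurable borel"
        by (intro borel_measurable_continuous_onI continuous_intros)
      ultimately have "(\<lambda>p. exp (- \<i> * of_real (snd p * norm (x - fst p))))
          \<in> borel_measurable (borel \<Otimes>\<^sub>M ?M)"
        by (rule measurable_compose)
      moreover have "(\<lambda>p. \<phi> (snd p)) \<in> borel_measurable ((borel :: (real^3) measure) \<Otimes>\<^sub>M ?M)"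
        by (rule measurable_compose[OF measurable_snd m])
      ultimately show ?thesis
        unfolding case_prod_beta by (rule borel_measurable_times)
    qed
  qed
  then have meas: "Pstar kmax x \<phi> \<in> borel_measurable (lebesgue_on D)"
    by (intro measurable_restrict_space1 measurable_completion) simp
  have bd: "norm (Pstar kmax x \<phi> y) \<le> (LINT s|?M. norm (\<phi> s))" for y
  proof -
    have "norm (Pstar kmax x \<phi> y)
        \<le> (LINT s|?M. norm (exp (- \<i> * of_real (s * norm (x - y))) * \<phi> s))"
      unfolding Pstar_def by (rule integral_norm_bound)
    also have "\<dots> = (LINT s|?M. norm (\<phi> s))"
      by (simp add: norm_mult)
    finally show ?thesis .
  qed
  have "D \<in> lmeasurable" using assms by (simp add: lmeasurable_open)
  then have "finite_measure (lebesgue_on D)" by (rule finite_measure_lebesgue_on)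
  then have "integrable (lebesgue_on D) (\<lambda>y. (norm (Pstar kmax x \<phi> y))\<^sup>2)"
  proof (rule finite_measure.integrable_const_bound
      [where B = "(LINT s|?M. norm (\<phi> s))\<^sup>2"])
    show "AE y in lebesgue_on D.
        norm ((norm (Pstar kmax x \<phi> y))\<^sup>2) \<le> (LINT s|?M. norm (\<phi> s))\<^sup>2"
      by (auto intro!: power_mono bd)
    show "(\<lambda>y. (norm (Pstar kmax x \<phi> y))\<^sup>2) \<in> borel_measurable (lebesgue_on D)"
      using meas by measurable
  qed
  with meas show ?thesis by (simp add: L2_def)
qed

end

theory Submission
  imports Defs
begin

text \<open>
  The phases of the kernel and of \<open>g x z\<close> multiply to \<open>exp (\<i> \<tau> s)\<close>, where \<open>\<tau>\<close> is the difference of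
  the distances from \<open>x\<close> to \<open>z\<close> and to \<open>y\<close>. So \<open>y\<close> enters only through \<open>\<tau>\<close>, and \<open>Pstar kmax x (g x z) y\<close>
  is the integral of that phase over the frequency band
  (\<open>Pstar_g_eq_band_integral\<close>). An antiderivative gives the closed form (\<open>band_integral_eq\<close>).

  Everything else is read off the closed form. For \<open>\<tau> \<noteq> 0\<close> its numerator is the chord of the unit
  circle over the arc of length \<open>\<bar>\<tau> kmax\<bar>\<close>. A chord is strictly shorter than its arc, which gives the
  bound \<open>kmax\<close> and shows that it is attained only at \<open>\<tau> = 0\<close> (\<open>norm_band_integral_less\<close>); a chord is
  also at most the diameter \<open>2\<close>, which gives the decay \<open>2 / \<tau>\<close>
  (\<open>norm_band_integral_le\<close>).
\<close>

lemma abs_sin_less_abs: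
  fixes t :: real
  assumes "t \<noteq> 0"
  shows "\<bar>sin t\<bar> < \<bar>t\<bar>"
proof -
  have *: "\<bar>sin u\<bar> < u" if "u > 0" for u :: real
  proof (cases "u \<le> 1")
    case True
    \<comment> \<open>By the mean value theorem \<open>sin u = u cos v\<close> with \<open>0 < v < 1\<close>, where the cosine is below \<open>1\<close>.\<close>
    obtain v where v: "0 < v" "v < u" "sin u - sin 0 = (u - 0) * cos v"
      using MVT2[OF \<open>u > 0\<close>, of sin cos] DERIV_sin by blast
    have "cos v < cos 0"
      using v True pi_gt3 by (intro cos_monotone_0_pi) auto
    then have "u * cos v < u"
      using that by simp
    moreover have "sin u > 0"
      using that True pi_gt3 by (intro sin_gt_zero) auto
    ultimately show ?thesis
      using v by simp
  next
    case False
    then show ?thesis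
      using abs_sin_le_one[of u] by linarith
  qed
  show ?thesis
    using *[of t] *[of "- t"] assms by (cases "t > 0") auto
qed

lemma chord_less_arc:
  fixes t :: real
  assumes "t \<noteq> 0"
  shows "norm (exp (\<i> * of_real t) - 1) < \<bar>t\<bar>"
  using abs_sin_less_abs[of "t / 2"] assms by (simp add: dist_exp_i_1)

lemma chord_le_diameter:
  fixes t :: real
  shows "norm (exp (\<i> * of_real t) - 1) \<le> 2"
  using abs_sin_le_one[of "t / 2"] by (simp add: dist_exp_i_1)

definition band_integral :: "real \<Rightarrow> real \<Rightarrow> complex" where
  "band_integral k \<tau> = (LINT s|lebesgue_on {0<..k}. exp (\<i> * of_real (\<tau> * s)))"

lemma Pstar_g_eq_band_integral:
  "Pstar k x (g x z) y = band_integral k (norm (x - z) - norm (x - y))"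
  unfolding Pstar_def g_def band_integral_def
  by (simp add: exp_add[symmetric] algebra_simps)

lemma continuous_imp_integrable_band:
  fixes f :: "real \<Rightarrow> 'a::euclidean_space"
  assumes "continuous_on {0..k} f"
  shows "integrable (lebesgue_on {0<..k}) f"
proof -
  have "set_integrable lebesgue {0..k} f"
    using assms by (rule absolutely_integrable_continuous_real)
  then have "set_integrable lebesgue {0<..k} f"
    by (rule set_integrable_subset) auto
  then show ?thesis
    by (simp add: integrable_restrict_space set_integrable_def)
qed

lemma g_in_L2: "g x z \<in> L2 {0<..k}"
proof -
  have c: "continuous_on S (g x z)" for S
    unfolding g_def[abs_def] by (intro continuous_intros)
  have "g x z \<in> borel_measurable (lebesgue_on {0<..k})"
    by (intro continuous_imp_measurable_on_sets_lebesgue c) auto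
  moreover have "integrable (lebesgue_on {0<..k}) (\<lambda>s. (norm (g x z s))\<^sup>2)"
    by (intro continuous_imp_integrable_band continuous_intros c)
  ultimately show ?thesis
    by (simp add: L2_def)
qed

lemma band_integral_eq:
  assumes "k \<ge> 0"
  shows "band_integral k \<tau> =
    (if \<tau> = 0 then of_real k else (exp (\<i> * of_real (\<tau> * k)) - 1) / (\<i> * of_real \<tau>))"
proof -
  let ?f = "\<lambda>s. exp (\<i> * of_real (\<tau> * s))"
  define F where "F s = (if \<tau> = 0 then of_real s else ?f s / (\<i> * of_real \<tau>))" for s
  have "(F has_vector_derivative ?f s) (at s within {0..k})" for s
  proof (cases "\<tau> = 0")
    case True
    then show ?thesis
      unfolding F_def by (auto intro!: derivative_eq_intros)
  next
    case False
    then have "((\<lambda>w. exp (\<i> * of_real \<tau> * w) / (\<i> * of_real \<tau>)) has_field_derivative ?f s)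
        (at (of_real s))"
      by (auto intro!: derivative_eq_intros simp: mult.assoc)
    then show ?thesis
      using False has_vector_derivative_real_field[of _ _ s]
      unfolding F_def by (auto simp: mult.assoc intro: has_vector_derivative_at_within)
  qed
  then have "(?f has_integral F k - F 0) {0..k}"
    using assms by (intro fundamental_theorem_of_calculus) auto
  then have "(?f has_integral F k - F 0) {0<..k}"
    by (subst has_integral_spike_set_eq[where T = "{0..k}"])
       (auto intro: negligible_subset[of "{0}"])
  moreover have "integrable (lebesgue_on {0<..k}) ?f"
    by (intro continuous_imp_integrable_band continuous_intros)
  ultimately have "band_integral k \<tau> = F k - F 0"
    unfolding band_integral_def
    by (subst lebesgue_integral_eq_integral) (auto intro: integral_unique)
  then show ?thesis
    by (simp add: F_def diff_divide_distrib)
qed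

lemma norm_band_integral_less:
  assumes "k > 0" and "\<tau> \<noteq> 0"
  shows "norm (band_integral k \<tau>) < k"
  using chord_less_arc[of "\<tau> * k"] assms
  by (simp add: band_integral_eq norm_divide norm_mult abs_mult field_simps)

lemma norm_band_integral_le:
  assumes "k \<ge> 0" and "\<tau> > 0"
  shows "norm (band_integral k \<tau>) \<le> 2 / \<tau>"
  using chord_le_diameter[of "\<tau> * k"] assms
  by (simp add: band_integral_eq norm_divide norm_mult divide_right_mono)

theorem theorem4p3:
  fixes D :: "(real^3) set" and \<Gamma> :: "(real^3) set" and kmax :: real
  assumes "bounded D" and "lipschitz_domain D" and "connected (- closure D)"
    and "kmax > 0"
    and "finite \<Gamma>" and "\<Gamma> \<subseteq> - closure D"
  shows "\<forall>x\<in>\<Gamma>.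
    (\<forall>z. g x z \<in> L2 {0<..kmax} \<and>
      (\<forall>y\<in>D. let \<tau> = norm (x - z) - norm (x - y) in
         Pstar kmax x (g x z) y =
           (if \<tau> = 0 then of_real kmax
            else (exp (\<i> * of_real (\<tau> * kmax)) - 1) / (\<i> * of_real \<tau>))) \<and>
      (\<forall>y\<in>D. \<forall>y'\<in>D. norm (y - x) = norm (y' - x) \<longrightarrow>
         Pstar kmax x (g x z) y = Pstar kmax x (g x z) y') \<and>
      (\<forall>y\<in>D. let \<tau> = norm (x - z) - norm (x - y) in
         norm (Pstar kmax x (g x z) y) \<le> kmax \<and>
         (norm (Pstar kmax x (g x z) y) = kmax \<longleftrightarrow> \<tau> = 0))) \<and>
    (\<exists>C>0. \<exists>T>0. \<forall>y\<in>D. \<forall>z. let \<tau> = norm (x - z) - norm (x - y) in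
       \<tau> \<ge> T \<longrightarrow> norm (Pstar kmax x (g x z) y) \<le> C / \<tau>)"
proof (intro ballI conjI allI impI)
  note k = \<open>kmax > 0\<close>
  fix x z
  show "g x z \<in> L2 {0<..kmax}"
    by (rule g_in_L2)
  fix y
  show "let \<tau> = norm (x - z) - norm (x - y) in
         Pstar kmax x (g x z) y =
           (if \<tau> = 0 then of_real kmax
            else (exp (\<i> * of_real (\<tau> * kmax)) - 1) / (\<i> * of_real \<tau>))"
    unfolding Let_def Pstar_g_eq_band_integral using k by (intro band_integral_eq) simp
  show "Pstar kmax x (g x z) y = Pstar kmax x (g x z) y'"
    if "norm (y - x) = norm (y' - x)" for y'
    using that by (simp add: Pstar_g_eq_band_integral norm_minus_commute)
  have "norm (band_integral kmax \<tau>) \<le> kmax \<and> (norm (band_integral kmax \<tau>) = kmax \<longleftrightarrow> \<tau> = 0)" for \<tau>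
    using norm_band_integral_less[OF k, of \<tau>] band_integral_eq[of kmax \<tau>] k
    by (cases "\<tau> = 0") auto
  then show "let \<tau> = norm (x - z) - norm (x - y) in
         norm (Pstar kmax x (g x z) y) \<le> kmax \<and>
         (norm (Pstar kmax x (g x z) y) = kmax \<longleftrightarrow> \<tau> = 0)"
    unfolding Let_def Pstar_g_eq_band_integral by blast
next
  fix x
  \<comment> \<open>The constant is the diameter of the unit circle; the threshold only keeps \<open>\<tau>\<close> positive.\<close>
  show "\<exists>C>0. \<exists>T>0. \<forall>y\<in>D. \<forall>z. let \<tau> = norm (x - z) - norm (x - y) in
       \<tau> \<ge> T \<longrightarrow> norm (Pstar kmax x (g x z) y) \<le> C / \<tau>"
    unfolding Let_def Pstar_g_eq_band_integral
    using \<open>kmax > 0\<close>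
    by (intro exI[of _ 2] exI[of _ 1] conjI ballI allI impI norm_band_integral_le) auto
qed

end
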